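(* Let $w_0(y)=\log\log\frac{e}{y}+1$ for $y\in(0,1]$. There exist a constant $A>0$, a function $v\in h^{\infty}_{w_0}(\mathbb{R}^2_+)\cap\mathcal{B}(\mathbb{R}^2_+)$, a number $k_0\in\mathbb{N}$ and a sequence $\{y_k\}_{k=k_0}^{\infty}$ of positive numbers with $y_k\to0$ such that for every $k\ge k_0$ $$\lambda_1\left(\left\{t\in[0,1]:\ |v(t,y_k)|\ge\frac{w_0(y_k)}{A}\right\}\right)\ge\frac{1}{10}.$$
   Context: $\mathbb{R}^2_+=\{(x,y):x\in\mathbb{R},\ y>0\}$; $\lambda_1$ is Lebesgue measure on $\mathbb{R}$; $w_0$ is extended by $w_0(y)=1$ for $y>1$. $h^{\infty}_{w_0}(\mathbb{R}^2_+)$ is the space of (real-valued) harmonic functions $v$ in $\mathbb{R}^2_+$ for which there is a constant $K$ with $|v(x,y)|\le K w_0(y)$ for all $(x,y)\in\mathbb{R}^2_+$. $\mathcal{B}(\mathbb{R}^2_+)$ is the Bloch class: harmonic functions $v$ in $\mathbb{R}^2_+$ for which there is a constant $D>0$ with $|\nabla v(x,y)|\le D/y$ for all $(x,y)\in\mathbb{R}^2_+$. *)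

theory Defs
  imports "HOL-Analysis.Analysis"
begin

definition upper_half_plane :: "(real \<times> real) set" where
  "upper_half_plane = {z. snd z > 0}"

text \<open>
  Classical harmonicity on an open set: \<open>v\<close> is twice continuously differentiable on \<open>S\<close> and its
  Laplacian vanishes there.  Nothing is required of \<open>v\<close> outside \<open>S\<close>.
\<close>

definition harmonic_on :: "(real \<times> real \<Rightarrow> real) \<Rightarrow> (real \<times> real) set \<Rightarrow> bool" where
  "harmonic_on v S \<longleftrightarrow>
    (\<exists>v\<^sub>x v\<^sub>y v\<^sub>x\<^sub>x v\<^sub>x\<^sub>y v\<^sub>y\<^sub>x v\<^sub>y\<^sub>y.
      (\<forall>z\<in>S. GDERIV v z :> (v\<^sub>x z, v\<^sub>y z)) \<and>
      (\<forall>z\<in>S. GDERIV v\<^sub>x z :> (v\<^sub>x\<^sub>x z, v\<^sub>x\<^sub>y z)) \<and>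
      (\<forall>z\<in>S. GDERIV v\<^sub>y z :> (v\<^sub>y\<^sub>x z, v\<^sub>y\<^sub>y z)) \<and>
      continuous_on S v\<^sub>x\<^sub>x \<and> continuous_on S v\<^sub>x\<^sub>y \<and>
      continuous_on S v\<^sub>y\<^sub>x \<and> continuous_on S v\<^sub>y\<^sub>y \<and>
      (\<forall>z\<in>S. v\<^sub>x\<^sub>x z + v\<^sub>y\<^sub>y z = 0))"

definition harmonic_growth_space :: "(real \<Rightarrow> real) \<Rightarrow> (real \<times> real \<Rightarrow> real) set" where
  "harmonic_growth_space w =
    {v. harmonic_on v upper_half_plane \<and>
        (\<exists>K. \<forall>x y. y > 0 \<longrightarrow> \<bar>v (x, y)\<bar> \<le> K * w y)}"

definition bloch_class :: "(real \<times> real \<Rightarrow> real) set" where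
  "bloch_class =
    {v. harmonic_on v upper_half_plane \<and>
        (\<exists>D>0. \<forall>x y. y > 0 \<longrightarrow> (\<exists>g. GDERIV v (x, y) :> g \<and> norm g \<le> D / y))}"

text \<open>Only the values at \<open>y > 0\<close> are meaningful.\<close>

definition w\<^sub>0 :: "real \<Rightarrow> real" where
  "w\<^sub>0 y = (if y \<le> 1 then ln (ln (exp 1 / y)) + 1 else 1)"

end

theory Submission
  imports Defs "HOL-Complex_Analysis.Complex_Analysis"
begin

text \<open>
  For a lacunary sequence of frequencies \<open>\<nu>\<^sub>i\<close> the Riesz products
  \<open>P\<^sub>j(x) = (\<Prod>i<j. 1 + (\<i>/M) cos (\<nu>\<^sub>i x))\<close>, \<open>j \<le> M\<^sup>2\<close>, are bounded by
  \<open>(1 + 1/M\<^sup>2)\<close> to the power \<open>M\<^sup>2/2\<close>, and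
  \<open>M (Im P\<^sub>j\<^sub>+\<^sub>1 - Im P\<^sub>j) = Re P\<^sub>j cos (\<nu>\<^sub>j x)\<close>.  So \<open>M Im P\<close> is a lacunary
  sum of \<open>M\<^sup>2\<close> terms with bounded coefficients, hence Bloch with a constant independent of \<open>M\<close>,
  and nevertheless of size \<open>O(M)\<close>.  By orthogonality the mean square of \<open>Im P\<close> for \<open>j = M\<^sup>2\<close>
  is at least \<open>1/2\<close>, so \<open>\<bar>M Im P\<bar>\<close> is comparable to \<open>M\<close> on a set of measure at least
  \<open>1/10\<close>.  Put such a block with \<open>M = 100\<^sup>m\<close> at the frequencies \<open>2\<pi> 4\<^sup>k\<close>,
  \<open>4\<^sup>M \<le> k < 4\<^sup>M + M\<^sup>2\<close>: there \<open>log log (1/y)\<close> is of order \<open>M\<close>, the earlier blocks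
  add up to a small fraction of \<open>M\<close>, and the later ones are invisible.  The function \<open>v\<close> is the sum
  of the blocks, where \<open>Re P\<^sub>j cos (\<nu>\<^sub>j x)\<close> is extended to the half-plane as the real part of
  an exponential times an entire function.
\<close>

section \<open>Riesz products\<close>

text \<open>The factor 2 pi makes the cosines orthogonal on the unit interval. The ratio 4 keeps
  doubled frequencies from resonating and makes all lower frequencies add up to at most a third of
  the next.\<close>

definition freq :: "nat \<Rightarrow> real" where
  "freq k = 2 * pi * 4 ^ k"

definition riesz :: "real \<Rightarrow> nat \<Rightarrow> nat \<Rightarrow> complex \<Rightarrow> complex" where
  "riesz t K j z = (\<Prod>i<j. 1 + \<i> * of_real t * cos (of_real (freq (K + i)) * z))"

text \<open>The entire function that agrees with \<open>Re (riesz t K j x)\<close> for real \<open>x\<close>.\<close>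

definition riesz_re :: "real \<Rightarrow> nat \<Rightarrow> nat \<Rightarrow> complex \<Rightarrow> complex" where
  "riesz_re t K j z = (riesz t K j z + riesz (- t) K j z) / 2"

text \<open>The exponential decays upwards at rate \<open>freq (K + j)\<close>, which outweighs the
  growth of \<open>riesz_re\<close>, at most a third of that rate; a cosine would not decay.\<close>

definition riesz_term :: "real \<Rightarrow> nat \<Rightarrow> nat \<Rightarrow> complex \<Rightarrow> complex" where
  "riesz_term t K j z = riesz_re t K j z * exp (\<i> * of_real (freq (K + j)) * z)"

lemma freq_ge_1: "freq k \<ge> 1"
proof -
  have "1 * 1 \<le> 2 * pi * 4 ^ k"
    using pi_ge_two by (intro mult_mono) auto
  then show ?thesis by (simp add: freq_def)
qed

lemma freq_pos [simp]: "freq k > 0"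
  by (simp add: freq_def)

lemma sum_freq_le: "(\<Sum>i<j. freq (K + i)) \<le> freq (K + j) / 3"
  by (induction j) (simp_all add: freq_def)

section \<open>Bounds for Riesz products and their terms in the complex plane\<close>

lemma norm_cos_diff_Re:
  "norm (cos z - cos (of_real (Re z))) \<le> exp \<bar>Im z\<bar> - 1"
proof -
  define x y where "x = Re z" and "y = Im z"
  have z: "z = of_real x + \<i> * of_real y" by (simp add: x_def y_def complex_eq)
  have "cos z - cos (of_real x) =
     (exp (\<i> * x) * (of_real (exp (-y)) - 1) + exp (- (\<i> * x)) * (of_real (exp y) - 1)) / 2"
    by (simp add: z cos_exp_eq algebra_simps exp_add [symmetric] exp_of_real [symmetric]
        add_divide_distrib diff_divide_distrib)
  also have "norm \<dots> \<le> (norm (exp (\<i> * x) * (of_real (exp (-y)) - 1)) +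
      norm (exp (- (\<i> * x)) * (of_real (exp y) - 1))) / 2"
    by (simp add: norm_divide norm_triangle_ineq)
  also have "\<dots> = (\<bar>exp (-y) - 1\<bar> + \<bar>exp y - 1\<bar>) / 2"
  proof -
    have *: "norm (complex_of_real s - 1) = \<bar>s - 1\<bar>" for s
      using norm_of_real[of "s - 1", where ?'a = complex] by simp
    show ?thesis by (simp only: norm_mult *) simp
  qed
  also have "(\<bar>exp (-y) - 1\<bar> + \<bar>exp y - 1\<bar>) / 2 \<le> exp \<bar>y\<bar> - 1"
  proof -
    have *: "exp y * exp (-y) = 1" by (simp flip: exp_add)
    have "exp y + exp (-y) \<ge> 2"
      using exp_gt_zero[of y] exp_gt_zero[of "-y"] *
      by (smt (verit) exp_ge_add_one_self)
    then show ?thesis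
      by (cases "y \<ge> 0") (auto simp: abs_if)
  qed
  finally show ?thesis by (simp add: x_def y_def)
qed

text \<open>Comparison with the factor at \<open>Re z\<close>, which is 1 plus an imaginary number
  and so has modulus at most \<open>sqrt (1 + t\<^sup>2)\<close>. The triangle inequality would only
  give 1 + |t| there, whose powers of order 1/t^2 are not bounded uniformly in
  \<open>t\<close>.\<close>

lemma norm_riesz_factor_le:
  assumes "\<bar>t\<bar> \<le> 1" "w \<ge> 0"
  shows "norm (1 + \<i> * of_real t * cos (of_real w * z)) \<le> sqrt (1 + t\<^sup>2) * exp (w * \<bar>Im z\<bar>)"
proof -
  define c where "c = cos (w * Re z)"
  define d where "d = cos (of_real w * z) - of_real c"
  have d: "norm d \<le> exp (w * \<bar>Im z\<bar>) - 1"
    using norm_cos_diff_Re[of "of_real w * z"] assms by (simp add: c_def d_def abs_mult flip: cos_of_real)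
  have "1 + \<i> * of_real t * cos (of_real w * z) = Complex 1 (t * c) + \<i> * of_real t * d"
    by (simp add: d_def complex_eq_iff algebra_simps)
  also have "norm \<dots> \<le> norm (Complex 1 (t * c)) + norm (\<i> * of_real t * d)"
    by (rule norm_triangle_ineq)
  also have "norm (Complex 1 (t * c)) \<le> sqrt (1 + t\<^sup>2)"
    using mult_left_mono[of "c\<^sup>2" 1 "t\<^sup>2"] abs_cos_le_one[of "w * Re z"]
    unfolding c_def [symmetric] by (simp add: cmod_def power_mult_distrib abs_square_le_1)
  also have "norm (\<i> * of_real t * d) \<le> 1 * (exp (w * \<bar>Im z\<bar>) - 1)"
    unfolding norm_mult using assms d by (intro mult_mono) auto
  \<comment> \<open>The square root, at least 1, is inserted so that the two summands combine into a
    product.\<close>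
  also have "1 * (exp (w * \<bar>Im z\<bar>) - 1) \<le> sqrt (1 + t\<^sup>2) * (exp (w * \<bar>Im z\<bar>) - 1)"
    using assms by (intro mult_right_mono) auto
  finally show ?thesis by (simp add: algebra_simps)
qed

text \<open>The factors \<open>sqrt (1 + t\<^sup>2)\<close> multiply to at most
  \<open>sqrt 3\<close>, since (1 + t^2)^j \<le> exp (j t^2) \<le> 3; the rates of the exponentials
  form a geometric sum.\<close>

lemma norm_riesz_le:
  assumes "\<bar>t\<bar> \<le> 1" "real j * t\<^sup>2 \<le> 1"
  shows "norm (riesz t K j z) \<le> sqrt 3 * exp (freq (K + j) / 3 * \<bar>Im z\<bar>)"
proof -
  have "norm (riesz t K j z) \<le> (\<Prod>i<j. sqrt (1 + t\<^sup>2) * exp (freq (K + i) * \<bar>Im z\<bar>))"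
    unfolding riesz_def prod_norm[symmetric]
    using assms by (intro prod_mono conjI norm_riesz_factor_le) (auto intro: less_imp_le)
  also have "\<dots> = sqrt ((1 + t\<^sup>2) ^ j) * exp ((\<Sum>i<j. freq (K + i)) * \<bar>Im z\<bar>)"
    by (simp add: prod.distrib exp_sum sum_distrib_right real_sqrt_power)
  also have "(1 + t\<^sup>2) ^ j \<le> 3"
  proof -
    have "(1 + t\<^sup>2) ^ j \<le> exp (t\<^sup>2) ^ j"
      by (intro power_mono) (auto simp: add_nonneg_nonneg)
    also have "\<dots> = exp (real j * t\<^sup>2)" by (simp add: exp_of_nat_mult)
    also have "\<dots> \<le> exp 1" using assms by simp
    also have "\<dots> \<le> 3" by (rule exp_le)
    finally show ?thesis .
  qed
  also have "(\<Sum>i<j. freq (K + i)) \<le> freq (K + j) / 3" by (rule sum_freq_le)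
  finally show ?thesis by (simp add: mult_right_mono mult_left_mono)
qed

text \<open>The rate 1/3 is relaxed to 1/2 and \<open>sqrt 3\<close> to 2. The lower half-plane is
  included because the circles in Cauchy's inequality may cross the real axis.\<close>

lemma norm_riesz_term_le:
  assumes "\<bar>t\<bar> \<le> 1" "real j * t\<^sup>2 \<le> 1"
  shows "norm (riesz_term t K j z) \<le> 2 * exp (freq (K + j) * (\<bar>Im z\<bar> / 2 - Im z))"
proof -
  have "norm (riesz_re t K j z) \<le> (norm (riesz t K j z) + norm (riesz (-t) K j z)) / 2"
    by (simp add: riesz_re_def norm_divide norm_triangle_ineq)
  also have "\<dots> \<le> sqrt 3 * exp (freq (K + j) / 3 * \<bar>Im z\<bar>)"
    using norm_riesz_le[of t j K z] norm_riesz_le[of "-t" j K z] assms by simp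
  also have "\<dots> \<le> 2 * exp (freq (K + j) / 2 * \<bar>Im z\<bar>)"
    by (intro mult_mono) (auto intro!: real_le_lsqrt mult_right_mono simp: less_imp_le)
  finally have "norm (riesz_term t K j z) \<le>
      2 * exp (freq (K + j) / 2 * \<bar>Im z\<bar>) * exp (- (freq (K + j) * Im z))"
    by (simp add: riesz_term_def norm_mult)
  also have "\<dots> = 2 * exp (freq (K + j) * (\<bar>Im z\<bar> / 2 - Im z))"
    by (simp add: mult.assoc algebra_simps flip: exp_add)
  finally show ?thesis .
qed

lemma norm_riesz_term_upper_le:
  assumes "\<bar>t\<bar> \<le> 1" "real j * t\<^sup>2 \<le> 1" "Im z \<ge> 0"
  shows "norm (riesz_term t K j z) \<le> 2 * exp (- freq (K + j) * Im z / 2)"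
  using norm_riesz_term_le[of t j K z] assms by (simp add: field_simps)

lemma holomorphic_riesz_term [holomorphic_intros]: "riesz_term t K j holomorphic_on S"
  unfolding riesz_term_def riesz_re_def riesz_def by (intro holomorphic_intros) auto

text \<open>Cauchy's inequality on a circle of radius \<open>1 / freq (K + j)\<close>, along which
  the exponent changes by a bounded amount.\<close>

lemma norm_deriv_riesz_term_le:
  assumes "\<bar>t\<bar> \<le> 1" "real j * t\<^sup>2 \<le> 1" "Im z \<ge> 0"
  shows "norm (deriv (riesz_term t K j) z) \<le>
    2 * exp (3/2) * freq (K + j) * exp (- freq (K + j) * Im z / 2)"
proof -
  define w where "w = freq (K + j)"
  have w: "w > 0" by (simp add: w_def)
  have "norm ((deriv ^^ 1) (riesz_term t K j) z) \<le>
      fact 1 * (2 * exp (3/2 - w * Im z / 2)) / (1 / w) ^ 1"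
  proof (rule Cauchy_inequality)
    fix u assume u: "norm (z - u) = 1 / w"
    have "\<bar>Im z - Im u\<bar> \<le> 1 / w" using abs_Im_le_cmod[of "z - u"] u by simp
    then have "w * \<bar>Im z - Im u\<bar> \<le> 1" using w by (simp add: field_simps)
    then have 1: "\<bar>w * Im z - w * Im u\<bar> \<le> 1"
      using w by (simp add: abs_mult flip: right_diff_distrib)
    have "w * (\<bar>Im u\<bar> / 2 - Im u) = \<bar>w * Im u\<bar> / 2 - w * Im u"
      using w by (simp add: abs_mult algebra_simps)
    \<comment> \<open>The worst case is \<open>Im u < 0\<close>, where the left side is -3/2 times
      \<open>w * Im u\<close> and \<open>w * Im u \<ge> w * Im z - 1\<close>.\<close>
    also have "\<dots> \<le> 3/2 - w * Im z / 2"
      using 1 w assms(3) mult_nonneg_nonneg[of w "Im z"] by linarith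
    finally show "norm (riesz_term t K j u) \<le> 2 * exp (3/2 - w * Im z / 2)"
      using norm_riesz_term_le[OF assms(1,2), of K u] by (smt (verit) exp_le_cancel_iff w_def)
  qed (use w in \<open>auto intro!: holomorphic_on_imp_continuous_on holomorphic_intros\<close>)
  moreover have "exp (3/2 - w * Im z / 2) = exp (3/2) * exp (- w * Im z / 2)"
    by (simp flip: exp_add)
  ultimately show ?thesis by (simp add: w_def mult_ac)
qed

text \<open>Mean value inequality on the closed upper half-plane, where the decay factor of the
  derivative is at most 1.\<close>

lemma norm_riesz_term_vertical_diff_le:
  assumes "\<bar>t\<bar> \<le> 1" "real j * t\<^sup>2 \<le> 1" "y \<ge> 0"
  shows "norm (riesz_term t K j (Complex x y) - riesz_term t K j (of_real x)) \<le>
    2 * exp (3/2) * freq (K + j) * y"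
proof -
  have "norm (riesz_term t K j (Complex x y) - riesz_term t K j (of_real x)) \<le>
    2 * exp (3/2) * freq (K + j) * norm (Complex x y - of_real x)"
  proof (rule field_differentiable_bound)
    show "convex {z. Im z \<ge> 0}" by (rule convex_halfspace_Im_ge)
    show "(riesz_term t K j has_field_derivative deriv (riesz_term t K j) z)
        (at z within {z. Im z \<ge> 0})" for z
      by (rule has_field_derivative_at_within, rule holomorphic_derivI[of _ UNIV])
        (auto intro: holomorphic_intros)
    show "norm (deriv (riesz_term t K j) z) \<le> 2 * exp (3/2) * freq (K + j)"
      if "z \<in> {z. Im z \<ge> 0}" for z
    proof -
      have "exp (- freq (K + j) * Im z / 2) \<le> 1" using that by (simp add: less_imp_le)
      then have "2 * exp (3/2) * freq (K + j) * exp (- freq (K + j) * Im z / 2)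
          \<le> 2 * exp (3/2) * freq (K + j) * 1"
        by (intro mult_left_mono) (auto simp: less_imp_le)
      moreover have "norm (deriv (riesz_term t K j) z) \<le>
          2 * exp (3/2) * freq (K + j) * exp (- freq (K + j) * Im z / 2)"
        using norm_deriv_riesz_term_le[OF assms(1,2), of z K] that by blast
      ultimately show ?thesis by (simp only: mult_1_right)
    qed
  qed (use assms in auto)
  also have "norm (Complex x y - of_real x) = y"
    using assms by (simp add: cmod_def)
  finally show ?thesis .
qed

text \<open>By 1 + x \<le> exp x at x = 3s/8, each summand is at most a multiple of a difference of
  consecutive values of exp (-u 4^k / 8), so the sum telescopes. The bound is uniform in
  \<open>u\<close> and \<open>n\<close>; this is why lacunary sums with bounded coefficients are
  Bloch.\<close>

lemma sum_lacunary_exp_le: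
  fixes u :: real
  assumes "u > 0"
  shows "(\<Sum>k<n. u * 4 ^ k * exp (- (u * 4 ^ k) / 2)) \<le> 8/3"
proof -
  have *: "s * exp (- s / 2) \<le> 8/3 * (exp (- s / 8) - exp (- (s * 4) / 8))" for s :: real
  proof -
    have "s * 3 / 8 * exp (- s / 2) \<le> (exp (s * 3 / 8) - 1) * exp (- s / 2)"
      using exp_ge_add_one_self[of "s * 3 / 8"] by (intro mult_right_mono) (linarith, simp)
    also have "\<dots> = exp (s * 3 / 8 + - s / 2) - exp (- s / 2)"
      unfolding exp_add by (simp add: algebra_simps)
    also have "\<dots> = exp (- s / 8) - exp (- (s * 4) / 8)"
      by simp
    finally show ?thesis by simp
  qed
  have "(\<Sum>k<n. u * 4 ^ k * exp (- (u * 4 ^ k) / 2)) \<le>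
     (\<Sum>k<n. 8/3 * (exp (- (u * 4 ^ k) / 8) - exp (- (u * 4 ^ Suc k) / 8)))"
    using *[of "u * 4 ^ _"] by (intro sum_mono) (simp add: mult_ac)
  also have "\<dots> = 8/3 * (exp (- u / 8) - exp (- (u * 4 ^ n) / 8))"
    unfolding sum_distrib_left[symmetric] by (subst sum_lessThan_telescope') simp
  also have "\<dots> \<le> 8/3"
  proof -
    have "8/3 * (a - b) \<le> 8/3" if "a \<le> 1" "b \<ge> 0" for a b :: real
      using that by simp
    from this[of "exp (- u / 8)" "exp (- (u * 4 ^ n) / 8)"] show ?thesis using assms by simp
  qed
  finally show ?thesis .
qed

section \<open>Values on the real line\<close>

text \<open>Conjugation changes the sign of \<open>t\<close>, so averaging over both signs yields
  the real part and multiplying the two yields the squared modulus.\<close>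

lemma cnj_riesz: "cnj (riesz t K j (of_real x)) = riesz (- t) K j (of_real x)"
  by (simp add: riesz_def cos_of_real flip: of_real_mult)

lemma riesz_re_of_real: "riesz_re t K j (of_real x) = of_real (Re (riesz t K j (of_real x)))"
  by (simp add: riesz_re_def complex_eq_iff flip: cnj_riesz)

text \<open>The last factor 1 + \<i> t cos adds t cos times the real part to the imaginary
  part.\<close>

lemma Re_riesz_term:
  "t * Re (riesz_term t K j (of_real x)) =
     Im (riesz t K (Suc j) (of_real x)) - Im (riesz t K j (of_real x))"
proof -
  have *: "exp (\<i> * of_real (freq (K + j)) * of_real x) = cis (freq (K + j) * x)"
    by (simp add: cis_conv_exp mult_ac)
  show ?thesis
    unfolding riesz_term_def riesz_re_of_real *
    by (simp add: riesz_def cos_of_real flip: of_real_mult)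
qed

lemma abs_Im_riesz_le:
  assumes "\<bar>t\<bar> \<le> 1" "real j * t\<^sup>2 \<le> 1"
  shows "\<bar>Im (riesz t K j (of_real x))\<bar> \<le> sqrt 3"
  using order_trans[OF abs_Im_le_cmod norm_riesz_le[OF assms, of K "of_real x"]] by simp

section \<open>The second moment on the unit interval\<close>

lemma has_integral_cis_period:
  "((\<lambda>x. cis (2 * pi * of_int m * x)) has_integral (if m = 0 then 1 else 0)) {0..1}"
proof (cases "m = 0")
  case True
  then show ?thesis using has_integral_const_real[of "1::complex" 0 1] by simp
next
  case False
  define c where "c = 2 * complex_of_real pi * of_int m * \<i>"
  define F where "F x = exp (c * of_real x) / c" for x :: real
  have "c \<noteq> 0" using False by (simp add: c_def)
  then have "(F has_vector_derivative exp (c * of_real x)) (at x within {0..1})" for x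
    unfolding F_def
    by (intro has_vector_derivative_real_field) (auto intro!: derivative_eq_intros)
  then have "((\<lambda>x. exp (c * of_real x)) has_integral (F 1 - F 0)) {0..1}"
    by (intro fundamental_theorem_of_calculus) auto
  moreover have *: "exp (c * of_real x) = cis (2 * pi * of_int m * x)" for x
    by (simp add: c_def cis_conv_exp mult_ac)
  moreover have "F 1 - F 0 = 0"
    using cis_multiple_2pi[of "of_int m"] unfolding F_def * by simp
  ultimately show ?thesis using False by (simp only: if_False)
qed

text \<open>Expanding the last factor moves \<open>m\<close> by 0, n or 2n in either direction, and
  only the unmoved term can have frequency zero. Doubled frequencies are allowed because squares of
  Riesz products contain them.\<close>

lemma has_integral_lacunary_prod:
  fixes \<alpha> \<beta> \<gamma> :: complex and m :: int
  assumes "m = 0 \<or> \<bar>m\<bar> \<ge> 4 ^ (K + j)"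
  shows "((\<lambda>x. (\<Prod>i<j. \<alpha> + \<beta> * of_real (cos (freq (K + i) * x)) + \<gamma> * of_real (cos (2 * freq (K + i) * x)))
            * cis (2 * pi * of_int m * x)) has_integral (if m = 0 then \<alpha> ^ j else 0)) {0..1}"
  using assms
proof (induction j arbitrary: m)
  case 0
  then show ?case using has_integral_cis_period[of m] by (simp only: lessThan_0 prod.empty mult_1 power_0)
next
  case (Suc j)
  define n :: int where "n = 4 ^ (K + j)"
  define P where "P x = (\<Prod>i<j. \<alpha> + \<beta> * of_real (cos (freq (K + i) * x)) +
    \<gamma> * of_real (cos (2 * freq (K + i) * x)))" for x
  define e where "e m x = cis (2 * pi * of_int m * x)" for m and x :: real
  have n: "n > 0" by (simp add: n_def)
  have e_mult: "e k x * e l x = e (k + l) x" for k l x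
    by (simp add: e_def cis_mult algebra_simps)
  have cos_e: "complex_of_real (cos (2 * pi * of_int k * x)) = (e k x + e (- k) x) / 2" for k x
    by (simp add: e_def complex_eq_iff)
  have c1: "complex_of_real (cos (freq (K + j) * x)) = (e n x + e (- n) x) / 2" for x
    by (subst cos_e [symmetric]) (simp add: freq_def n_def)
  have c2: "complex_of_real (cos (2 * freq (K + j) * x)) = (e (2 * n) x + e (- (2 * n)) x) / 2" for x
    by (subst cos_e [symmetric]) (simp add: freq_def n_def mult_ac)
  have IH: "((\<lambda>x. P x * e k x) has_integral (if k = 0 then \<alpha> ^ j else 0)) {0..1}"
    if "k = 0 \<or> \<bar>k\<bar> \<ge> n" for k
    using Suc.IH[of k] that by (simp add: P_def e_def n_def)
  have m: "m = 0 \<or> \<bar>m\<bar> \<ge> 4 * n" using Suc.prems by (simp add: n_def)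
  have IH_0: "((\<lambda>x. P x * e k x) has_integral 0) {0..1}" if "k \<noteq> 0" "\<bar>k\<bar> \<ge> n" for k
    using IH[of k] that by simp
  \<comment> \<open>The ratio 4 enters here: starting from m = 0 or |m| \<ge> 4n, a shift by n or 2n
    leaves a frequency of size at least n, to which the induction hypothesis applies.\<close>
  have ne: "m + n \<noteq> 0" "\<bar>m + n\<bar> \<ge> n" "m - n \<noteq> 0" "\<bar>m - n\<bar> \<ge> n" "m + 2 * n \<noteq> 0"
    "\<bar>m + 2 * n\<bar> \<ge> n" "m - 2 * n \<noteq> 0" "\<bar>m - 2 * n\<bar> \<ge> n"
    using m n by arith+
  have "((\<lambda>x. \<alpha> * (P x * e m x) + \<beta> / 2 * (P x * e (m + n) x + P x * e (m - n) x)
      + \<gamma> / 2 * (P x * e (m + 2 * n) x + P x * e (m - 2 * n) x))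
      has_integral (\<alpha> * (if m = 0 then \<alpha> ^ j else 0) + \<beta> / 2 * (0 + 0) + \<gamma> / 2 * (0 + 0))) {0..1}"
    using ne m n by (intro has_integral_add has_integral_mult_right IH IH_0) auto
  then have "((\<lambda>x. P x * (\<alpha> + \<beta> * ((e n x + e (- n) x) / 2) +
      \<gamma> * ((e (2 * n) x + e (- (2 * n)) x) / 2)) * e m x)
      has_integral (if m = 0 then \<alpha> ^ Suc j else 0)) {0..1}"
    unfolding diff_conv_add_uminus e_mult [symmetric]
    by (rule has_integral_eq_rhs [OF has_integral_eq, rotated 1])
       (simp_all add: field_simps)
  then show ?case
    by (simp only: prod.lessThan_Suc c1 c2 P_def e_def)
qed

text \<open>For the Riesz product P, (Im P)^2 = |P|^2 / 2 - Re (P^2) / 2. Both |P|^2 and P^2 are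
  products of the form above, with constant terms 1 + t^2/2 and 1 - t^2/2 in each factor, and only
  the powers of these survive integration.\<close>

lemma has_integral_Im_riesz_squared:
  "((\<lambda>x. (Im (riesz t K j (of_real x)))\<^sup>2) has_integral
     ((1 + t\<^sup>2 / 2) ^ j - (1 - t\<^sup>2 / 2) ^ j) / 2) {0..1}"
proof -
  define h where "h = complex_of_real (t\<^sup>2 / 2)"
  define Q where "Q \<alpha> \<beta> \<gamma> x = (\<Prod>i<j. \<alpha> + \<beta> * of_real (cos (freq (K + i) * x)) +
    \<gamma> * complex_of_real (cos (2 * freq (K + i) * x)))" for \<alpha> \<beta> \<gamma> :: complex and x :: real
  have Q: "((\<lambda>x. Q \<alpha> \<beta> \<gamma> x) has_integral \<alpha> ^ j) {0..1}" for \<alpha> \<beta> \<gamma>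
    using has_integral_lacunary_prod[of 0 K j \<alpha> \<beta> \<gamma>] by (simp add: Q_def)
  have cc: "cos (2 * freq k * x) = 2 * (cos (freq k * x))\<^sup>2 - 1" for k x
    using cos_double_cos[of "freq k * x"] by (simp add: mult.assoc)
  have c: "cos (complex_of_real (freq k) * of_real x) = of_real (cos (freq k * x))" for k x
    by (simp add: cos_of_real flip: of_real_mult)
  have norm_sq: "riesz t K j (of_real x) * riesz (- t) K j (of_real x) = Q (1 + h) 0 h x" for x
    unfolding riesz_def Q_def prod.distrib [symmetric]
    by (intro prod.cong refl, unfold c cc h_def) (simp add: field_simps power2_eq_square)
  have sq: "(riesz s K j (of_real x))\<^sup>2 = Q (1 - h) (2 * \<i> * of_real s) (- h) x" if "s\<^sup>2 = t\<^sup>2" for s x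
    unfolding riesz_def Q_def power2_eq_square[of "prod _ _"] prod.distrib [symmetric] h_def that [symmetric]
    by (intro prod.cong refl, unfold c cc) (simp add: field_simps power2_eq_square)
  have "((\<lambda>x. Q (1 + h) 0 h x / 2 - (Q (1 - h) (2 * \<i> * of_real t) (- h) x +
            Q (1 - h) (2 * \<i> * of_real (- t)) (- h) x) / 4) has_integral
         (1 + h) ^ j / 2 - ((1 - h) ^ j + (1 - h) ^ j) / 4) {0..1}"
    by (intro has_integral_diff has_integral_add has_integral_divide Q)
  then have "((\<lambda>x. Re (Q (1 + h) 0 h x / 2 - (Q (1 - h) (2 * \<i> * of_real t) (- h) x +
            Q (1 - h) (2 * \<i> * of_real (- t)) (- h) x) / 4)) has_integral
         Re ((1 + h) ^ j / 2 - ((1 - h) ^ j + (1 - h) ^ j) / 4)) {0..1}"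
    by (rule has_integral_Re)
  moreover have "Q (1 + h) 0 h x / 2 - (Q (1 - h) (2 * \<i> * of_real t) (- h) x +
            Q (1 - h) (2 * \<i> * of_real (- t)) (- h) x) / 4 =
            of_real ((Im (riesz t K j (of_real x)))\<^sup>2)" for x
  proof -
    have "Q (1 + h) 0 h x / 2 - (Q (1 - h) (2 * \<i> * of_real t) (- h) x +
            Q (1 - h) (2 * \<i> * of_real (- t)) (- h) x) / 4 =
       - ((riesz t K j (of_real x) - riesz (- t) K j (of_real x)) / 2)\<^sup>2"
      unfolding norm_sq [symmetric] sq[of t, OF refl, symmetric] sq[of "-t", OF power2_minus, symmetric]
      by (simp add: power2_eq_square algebra_simps add_divide_distrib diff_divide_distrib)
    also have "(riesz t K j (of_real x) - riesz (- t) K j (of_real x)) / 2 =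
        \<i> * of_real (Im (riesz t K j (of_real x)))"
      by (simp add: complex_eq_iff flip: cnj_riesz)
    finally show ?thesis by (simp add: power_mult_distrib)
  qed
  moreover have "(1 + h) ^ j / 2 - ((1 - h) ^ j + (1 - h) ^ j) / 4 =
     of_real (((1 + t\<^sup>2 / 2) ^ j - (1 - t\<^sup>2 / 2) ^ j) / 2)"
    by (simp add: h_def diff_divide_distrib)
  ultimately show ?thesis by (simp only: Re_complex_of_real)
qed

text \<open>Bernoulli's inequality for both \<open>h\<close> and \<open>-h\<close> drives the
  induction. With h = t^2/2 and j t^2 = 1 the difference is at least 1, so the mean square is at
  least 1/2.\<close>

lemma power_diff_ge_linear:
  fixes h :: real
  assumes "0 \<le> h" "h \<le> 1"
  shows "(1 + h) ^ n - (1 - h) ^ n \<ge> 2 * real n * h"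
proof (induction n)
  case (Suc n)
  have "(1 + h) ^ n + (1 - h) ^ n \<ge> (1 + real n * h) + (1 + real n * (- h))"
    using Bernoulli_inequality[of h n] Bernoulli_inequality[of "-h" n] assms by (intro add_mono) auto
  then have "h * ((1 + h) ^ n + (1 - h) ^ n) \<ge> h * 2"
    using assms by (intro mult_left_mono) auto
  with Suc show ?case by (simp add: algebra_simps)
qed simp

lemma continuous_on_Im_riesz: "continuous_on S (\<lambda>x. Im (riesz t K j (complex_of_real x)))"
  unfolding riesz_def by (intro continuous_intros)

lemma lmeasurable_superlevel:
  fixes f :: "real \<Rightarrow> real"
  assumes "continuous_on {a..b} f"
  shows "{t \<in> {a..b}. \<bar>f t\<bar> \<ge> c} \<in> lmeasurable"
proof -
  have "closed {t \<in> {a..b}. \<bar>f t\<bar> \<ge> c}"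
    using assms by (intro continuous_on_closed_Collect_le continuous_intros) auto
  moreover have "bounded {t \<in> {a..b}. \<bar>f t\<bar> \<ge> c}"
    by (rule bounded_subset[of "{a..b}"]) auto
  ultimately show ?thesis by (simp add: lmeasurable_compact compact_eq_bounded_closed)
qed

text \<open>The square is at most 4/25 off the set and at most 3 on it, while its mean is at least
  1/2; so the measure is at least (1/2 - 4/25) / 3 > 1/10.\<close>

lemma measure_abs_Im_riesz_ge:
  assumes "\<bar>t\<bar> \<le> 1" "real j * t\<^sup>2 = 1"
  shows "measure lebesgue {x \<in> {0..1}. \<bar>Im (riesz t K j (of_real x))\<bar> \<ge> 2/5} \<ge> 1/10"
proof -
  define B where "B x = Im (riesz t K j (of_real x))" for x
  define S where "S = {x \<in> {0..1}. \<bar>B x\<bar> \<ge> 2/5}"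
  have "S \<in> lmeasurable"
    unfolding S_def B_def by (intro lmeasurable_superlevel continuous_on_Im_riesz)
  then have "((\<lambda>x. 1::real) has_integral measure lebesgue S) S"
    by (simp add: lmeasure_integral integrable_integral flip: lmeasurable_iff_integrable_on)
  then have "((\<lambda>x. if x \<in> S then 1 else 0 :: real) has_integral measure lebesgue S) {0..1}"
    by (rule has_integral_restrict[THEN iffD2, rotated]) (auto simp: S_def)
  from has_integral_add[OF has_integral_const_real[of "4/25 :: real" 0 1] has_integral_mult_right[OF this, of 3]]
  have "((\<lambda>x. 4/25 + 3 * (if x \<in> S then 1 else 0)) has_integral 4/25 + 3 * measure lebesgue S) {0..1}"
    by simp
  moreover have "(B x)\<^sup>2 \<le> 4/25 + 3 * (if x \<in> S then 1 else 0)" if "x \<in> {0..1}" for x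
  proof (cases "x \<in> S")
    case True
    have "\<bar>B x\<bar>\<^sup>2 \<le> (sqrt 3)\<^sup>2"
      using abs_Im_riesz_le[of t j K x] assms by (intro power_mono) (auto simp: B_def)
    with True show ?thesis by simp
  next
    case False
    then have "\<bar>B x\<bar>\<^sup>2 \<le> (2/5)\<^sup>2" using that by (intro power_mono) (auto simp: S_def)
    with False show ?thesis by (simp add: power2_eq_square)
  qed
  moreover define D where "D = (1 + t\<^sup>2 / 2) ^ j - (1 - t\<^sup>2 / 2) ^ j"
  ultimately have "D / 2 \<le> 4/25 + 3 * measure lebesgue S"
    using has_integral_le[OF has_integral_Im_riesz_squared[of t K j, folded B_def D_def]] by blast
  moreover have "D \<ge> 2 * real j * (t\<^sup>2 / 2)"
    unfolding D_def
  proof (rule power_diff_ge_linear)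
    have "t\<^sup>2 \<le> 1" using assms(1) by (simp add: abs_square_le_1)
    then show "t\<^sup>2 / 2 \<le> 1" by simp
  qed simp
  then have "D \<ge> 1" using assms(2) by simp
  ultimately have "measure lebesgue S \<ge> 1/10" by linarith
  then show ?thesis unfolding S_def B_def .
qed

section \<open>The sum of the blocks\<close>

text \<open>The base 100 makes each amplitude dominate the sum of all earlier ones.\<close>

definition amp :: "nat \<Rightarrow> nat" where
  "amp m = 100 ^ m"

definition start :: "nat \<Rightarrow> nat" where
  "start m = 4 ^ amp m"

definition len :: "nat \<Rightarrow> nat" where
  "len m = (amp m)\<^sup>2"

definition block :: "nat \<Rightarrow> complex \<Rightarrow> complex" where
  "block m z = (\<Sum>j<len m. riesz_term (1 / amp m) (start m) j z)"

text \<open>Up to constants, this bounds \<open>y\<close> times the gradient of the term of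
  frequency \<open>freq k\<close> at height \<open>y\<close>, and also the error of a sharp cutoff
  at frequency \<open>1 / y\<close>.\<close>

definition weight :: "real \<Rightarrow> nat \<Rightarrow> real" where
  "weight y k = freq k * y * exp (- freq k * y / 2)"

definition block_weight :: "real \<Rightarrow> nat \<Rightarrow> real" where
  "block_weight y m = (\<Sum>j<len m. weight y (start m + j))"

text \<open>The boundary values of block \<open>m\<close>, truncated to the frequencies that are visible at
  height \<open>y\<close>; the sum telescopes to a Riesz product.\<close>

definition riesz_part :: "real \<Rightarrow> real \<Rightarrow> nat \<Rightarrow> real" where
  "riesz_part x y m = amp m * Im (riesz (1 / amp m) (start m)
     (card {j. j < len m \<and> freq (start m + j) * y \<le> 1}) (of_real x))"

section \<open>Arithmetic of the amplitudes and of the positions of the blocks\<close>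

lemma amp_pos [simp]: "amp m > 0"
  by (simp add: amp_def)

lemma freq_mono: "k \<le> l \<Longrightarrow> freq k \<le> freq l"
  by (simp add: freq_def)

lemma
  shows abs_step_le: "\<bar>1 / real (amp m)\<bar> \<le> 1"
    and step_squared_le: "j \<le> len m \<Longrightarrow> real j * (1 / real (amp m))\<^sup>2 \<le> 1"
    and len_step_squared: "real (len m) * (1 / real (amp m))\<^sup>2 = 1"
proof -
  have "1 \<le> amp m" by (simp add: amp_def)
  then show "\<bar>1 / real (amp m)\<bar> \<le> 1" by simp
  show *: "real (len m) * (1 / real (amp m))\<^sup>2 = 1" by (simp add: len_def power_divide)
  assume "j \<le> len m"
  then have "real j * (1 / real (amp m))\<^sup>2 \<le> real (len m) * (1 / real (amp m))\<^sup>2"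
    by (intro mult_right_mono) auto
  then show "real j * (1 / real (amp m))\<^sup>2 \<le> 1" using * by simp
qed

lemma square_le_power4: "n\<^sup>2 \<le> (4::nat) ^ n"
proof -
  have "n\<^sup>2 \<le> (2 ^ n)\<^sup>2" using less_exp[of n] by (intro power_mono) auto
  also have "\<dots> = 4 ^ n" by (simp add: power2_eq_square flip: power_mult_distrib)
  finally show ?thesis .
qed

text \<open>A block starting at 4^M has length M^2 \<le> 4^M, hence ends by 2 * 4^M, well before the
  next start 4^(100 M).\<close>

lemma block_end_less: "start m + len m < start (Suc m)"
proof -
  have "start m + len m \<le> 4 ^ amp m + 4 ^ amp m"
    unfolding start_def len_def by (intro add_mono square_le_power4) auto
  also have "\<dots> < 4 ^ Suc (amp m)" by simp
  also have "\<dots> \<le> start (Suc m)"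
    unfolding start_def by (intro power_increasing) (auto simp: amp_def Suc_le_eq)
  finally show ?thesis .
qed

lemma start_mono: "m \<le> n \<Longrightarrow> start m \<le> start n"
  by (rule lift_Suc_mono_le[of start]) (use block_end_less in \<open>auto intro: less_imp_le add_lessD1\<close>)

text \<open>The blocks occupy disjoint ranges of indices below \<open>start n\<close>; the gaps
  between them only add nonnegative terms.\<close>

lemma sum_blocks_le:
  fixes f :: "nat \<Rightarrow> real"
  assumes "\<And>k. f k \<ge> 0"
  shows "(\<Sum>m<n. \<Sum>j<len m. f (start m + j)) \<le> (\<Sum>k<start n. f k)"
proof (induction n)
  case (Suc n)
  have split: "(\<Sum>k<a + b. f k) = (\<Sum>k<a. f k) + (\<Sum>j<b. f (a + j))" for a b
    by (induction b) auto
  have "(\<Sum>m<Suc n. \<Sum>j<len m. f (start m + j)) \<le> (\<Sum>k<start n + len n. f k)"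
    using Suc by (simp add: split)
  also have "\<dots> \<le> (\<Sum>k<start (Suc n). f k)"
    using block_end_less[of n] assms by (intro sum_mono2) auto
  finally show ?case .
qed (simp add: sum_nonneg assms)

section \<open>Summability of the weights and bounds for the blocks\<close>

lemma weight_nonneg: "y \<ge> 0 \<Longrightarrow> weight y k \<ge> 0"
  by (simp add: weight_def less_imp_le)

lemma block_weight_nonneg: "y \<ge> 0 \<Longrightarrow> block_weight y k \<ge> 0"
  by (simp add: block_weight_def sum_nonneg weight_nonneg)

lemma sum_block_weight_le:
  assumes "y > 0"
  shows "(\<Sum>m<n. block_weight y m) \<le> 8/3"
proof -
  have "(\<Sum>m<n. block_weight y m) \<le> (\<Sum>k<start n. weight y k)"
    unfolding block_weight_def using assms by (intro sum_blocks_le weight_nonneg) auto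
  also have "\<dots> \<le> 8/3"
    using sum_lacunary_exp_le[of "2 * pi * y" "start n"] assms
    by (simp add: weight_def freq_def mult_ac)
  finally show ?thesis .
qed

lemma summable_block_weight: "y > 0 \<Longrightarrow> summable (block_weight y)"
  by (rule summableI_nonneg_bounded[OF block_weight_nonneg sum_block_weight_le]) auto

lemma suminf_block_weight_le: "y > 0 \<Longrightarrow> suminf (block_weight y) \<le> 8/3"
  by (rule suminf_le_const[OF summable_block_weight sum_block_weight_le])

text \<open>A crude bound for locally uniform convergence; the frequency in the weight is introduced
  by \<open>freq k \<ge> 1\<close>.\<close>

lemma norm_block_le:
  assumes "y > 0" "Im z \<ge> y"
  shows "norm (block m z) \<le> 2 / y * block_weight y m"
proof -
  have "norm (block m z) \<le> (\<Sum>j<len m. 2 / y * weight y (start m + j))"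
    unfolding block_def
  proof (rule sum_norm_le)
    fix j assume j: "j \<in> {..<len m}"
    define w where "w = freq (start m + j)"
    have w: "w \<ge> 1" unfolding w_def by (rule freq_ge_1)
    have "norm (riesz_term (1 / amp m) (start m) j z) \<le> 2 * exp (- w * Im z / 2)"
      unfolding w_def using j assms
      by (intro norm_riesz_term_upper_le abs_step_le step_squared_le) auto
    also have "\<dots> \<le> 2 * (w * exp (- w * y / 2))"
    proof -
      have "w * y \<le> w * Im z" using w assms by (intro mult_left_mono) auto
      then have "1 * exp (- w * Im z / 2) \<le> w * exp (- w * y / 2)"
        using w by (intro mult_mono) auto
      then show ?thesis by simp
    qed
    also have "\<dots> = 2 / y * weight y (start m + j)"
      using assms by (simp add: weight_def w_def)
    finally show "norm (riesz_term (1 / amp m) (start m) j z) \<le> 2 / y * weight y (start m + j)" .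
  qed
  then show ?thesis by (simp add: block_weight_def sum_distrib_left)
qed

lemma block_has_field_derivative:
  "(block m has_field_derivative (\<Sum>j<len m. deriv (riesz_term (1 / amp m) (start m) j) z)) (at z)"
  unfolding block_def
  by (intro derivative_intros holomorphic_derivI[of _ UNIV] holomorphic_intros) auto

lemma norm_deriv_block_le:
  assumes "Im z > 0"
  shows "norm (\<Sum>j<len m. deriv (riesz_term (1 / amp m) (start m) j) z) \<le>
    2 * exp (3/2) / Im z * block_weight (Im z) m"
proof -
  have "norm (\<Sum>j<len m. deriv (riesz_term (1 / amp m) (start m) j) z) \<le>
     (\<Sum>j<len m. 2 * exp (3/2) / Im z * weight (Im z) (start m + j))"
  proof (rule sum_norm_le)
    fix j assume "j \<in> {..<len m}"
    then have "norm (deriv (riesz_term (1 / amp m) (start m) j) z) \<le>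
      2 * exp (3/2) * freq (start m + j) * exp (- freq (start m + j) * Im z / 2)"
      using assms by (intro norm_deriv_riesz_term_le abs_step_le step_squared_le) auto
    also have "\<dots> = 2 * exp (3/2) / Im z * weight (Im z) (start m + j)"
      using assms by (simp add: weight_def)
    finally show "norm (deriv (riesz_term (1 / amp m) (start m) j) z) \<le>
      2 * exp (3/2) / Im z * weight (Im z) (start m + j)" .
  qed
  then show ?thesis by (simp add: block_weight_def sum_distrib_left)
qed

section \<open>Truncation of a block to the frequencies visible at a given height\<close>

lemma down_closed_eq_lessThan_card:
  fixes S :: "nat set"
  assumes "finite S" "\<And>i j. j \<in> S \<Longrightarrow> i \<le> j \<Longrightarrow> i \<in> S"
  shows "S = {..<card S}"
proof (cases "S = {}")
  case False
  then have "Max S \<in> S" using assms(1) by (rule Max_in[rotated])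
  have "S = {..Max S}"
  proof (intro equalityI subsetI)
    show "i \<in> {..Max S}" if "i \<in> S" for i using assms(1) that by simp
    show "i \<in> S" if "i \<in> {..Max S}" for i using assms(2)[OF \<open>Max S \<in> S\<close>] that by simp
  qed
  then show ?thesis by (metis card_atMost lessThan_Suc_atMost)
qed simp

lemma sum_Re_riesz_term:
  assumes "t \<noteq> 0"
  shows "(\<Sum>j<n. Re (riesz_term t K j (of_real x))) = Im (riesz t K n (of_real x)) / t"
proof -
  have "(\<Sum>j<n. t * Re (riesz_term t K j (of_real x))) = Im (riesz t K n (of_real x)) - Im (riesz t K 0 (of_real x))"
    unfolding Re_riesz_term by (rule sum_lessThan_telescope)
  then show ?thesis using assms by (simp add: riesz_def field_simps flip: sum_distrib_left)
qed

text \<open>At height \<open>y\<close> the terms of frequency at most \<open>1 / y\<close> are close to their boundary values,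
  and the remaining ones are negligible.\<close>

lemma riesz_term_cutoff:
  assumes "j < len m" "y > 0"
  shows "\<bar>Re (riesz_term (1 / amp m) (start m) j (Complex x y)) -
     (if freq (start m + j) * y \<le> 1 then Re (riesz_term (1 / amp m) (start m) j (of_real x)) else 0)\<bar>
     \<le> 2 * exp 2 * weight y (start m + j)"
proof -
  define w where "w = freq (start m + j)"
  define T where "T = riesz_term (1 / amp m) (start m) j"
  have w: "w > 0" by (simp add: w_def)
  show ?thesis
  proof (cases "w * y \<le> 1")
    case True
    have "\<bar>Re (T (Complex x y)) - Re (T (of_real x))\<bar> \<le> norm (T (Complex x y) - T (of_real x))"
      using abs_Re_le_cmod[of "T (Complex x y) - T (of_real x)"] by simp
    also have "\<dots> \<le> 2 * exp (3/2) * w * y"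
      unfolding T_def w_def using assms
      by (intro norm_riesz_term_vertical_diff_le abs_step_le step_squared_le) auto
    \<comment> \<open>The decay factor of the weight is inserted at the cost of a constant, as
      \<open>w * y \<le> 1\<close> gives 3/2 \<le> 2 - w y / 2.\<close>
    also have "\<dots> \<le> 2 * exp (2 - w * y / 2) * (w * y)"
      using True w assms by (simp add: mult_right_mono)
    also have "\<dots> = 2 * exp 2 * weight y (start m + j)"
    proof -
      have "exp (2 - w * y / 2) = exp 2 * exp (- w * y / 2)" by (simp flip: exp_add)
      then show ?thesis by (simp add: weight_def w_def)
    qed
    finally show ?thesis using True by (simp add: T_def w_def)
  next
    case False
    have "\<bar>Re (T (Complex x y))\<bar> \<le> norm (T (Complex x y))" by (rule abs_Re_le_cmod)
    also have "\<dots> \<le> 2 * exp (- w * y / 2)"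
      using assms norm_riesz_term_upper_le[of "1 / amp m" j "Complex x y" "start m"]
        abs_step_le[of m] step_squared_le[of j m] by (simp add: T_def w_def)
    also have "\<dots> \<le> 2 * (exp 2 * (w * y) * exp (- w * y / 2))"
    proof -
      have "1 * 1 \<le> exp 2 * (w * y)" using False by (intro mult_mono) auto
      then have "1 * exp (- w * y / 2) \<le> exp 2 * (w * y) * exp (- w * y / 2)"
        by (intro mult_right_mono) auto
      then show ?thesis by simp
    qed
    finally show ?thesis using False by (simp add: T_def w_def weight_def mult_ac)
  qed
qed

lemma block_approx:
  assumes "y > 0"
  shows "\<bar>Re (block m (Complex x y)) - riesz_part x y m\<bar> \<le> 2 * exp 2 * block_weight y m"
proof -
  define T where "T = riesz_term (1 / amp m) (start m)"
  define S where "S = {j. j < len m \<and> freq (start m + j) * y \<le> 1}"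
  \<comment> \<open>Frequencies increase with the index, so the visible indices form an initial
    segment and their terms telescope to a Riesz product.\<close>
  have "S = {..<card S}"
  proof (rule down_closed_eq_lessThan_card)
    show "i \<in> S" if "j \<in> S" "i \<le> j" for i j
    proof -
      have "freq (start m + i) * y \<le> freq (start m + j) * y"
        using that assms by (intro mult_right_mono freq_mono) auto
      then show ?thesis using that by (auto simp: S_def)
    qed
  qed (simp add: S_def)
  then have "riesz_part x y m = (\<Sum>j\<in>S. Re (T j (of_real x)))"
    using sum_Re_riesz_term[of "1 / amp m" "start m" x "card S"]
    by (simp add: riesz_part_def T_def S_def)
  also have "\<dots> = (\<Sum>j<len m. if freq (start m + j) * y \<le> 1 then Re (T j (of_real x)) else 0)"
    by (simp add: S_def sum.If_cases Int_def)
  finally have "\<bar>Re (block m (Complex x y)) - riesz_part x y m\<bar> =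
     \<bar>\<Sum>j<len m. Re (T j (Complex x y)) - (if freq (start m + j) * y \<le> 1 then Re (T j (of_real x)) else 0)\<bar>"
    by (simp add: block_def T_def sum_subtractf)
  also have "\<dots> \<le> (\<Sum>j<len m. 2 * exp 2 * weight y (start m + j))"
    unfolding T_def using assms by (intro sum_abs[THEN order_trans] sum_mono riesz_term_cutoff) auto
  finally show ?thesis by (simp add: block_weight_def sum_distrib_left)
qed

lemma abs_riesz_part_le: "\<bar>riesz_part x y m\<bar> \<le> 2 * real (amp m)"
proof -
  have "card {j. j < len m \<and> freq (start m + j) * y \<le> 1} \<le> len m"
    using card_mono[of "{..<len m}" "{j. j < len m \<and> freq (start m + j) * y \<le> 1}"] by auto
  then have "\<bar>riesz_part x y m\<bar> \<le> amp m * sqrt 3"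
    unfolding riesz_part_def abs_mult
    by (intro mult_mono abs_Im_riesz_le abs_step_le step_squared_le) auto
  also have "\<dots> \<le> real (amp m) * 2"
    by (intro mult_left_mono real_le_lsqrt) auto
  finally show ?thesis by simp
qed

lemma riesz_part_eq_0:
  assumes "freq (start m) * y > 1" "y > 0"
  shows "riesz_part x y m = 0"
proof -
  have "\<not> freq (start m + j) * y \<le> 1" for j
  proof -
    have "freq (start m) * y \<le> freq (start m + j) * y"
      using assms by (intro mult_right_mono freq_mono) auto
    then show ?thesis using assms by linarith
  qed
  then show ?thesis by (simp add: riesz_part_def riesz_def)
qed

lemma riesz_part_full:
  assumes "freq (start m + len m) * y \<le> 1" "y > 0"
  shows "riesz_part x y m = amp m * Im (riesz (1 / amp m) (start m) (len m) (of_real x))"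
proof -
  have "freq (start m + j) * y \<le> 1" if "j < len m" for j
  proof -
    have "freq (start m + j) * y \<le> freq (start m + len m) * y"
      using assms that by (intro mult_right_mono freq_mono) auto
    then show ?thesis using assms by linarith
  qed
  then have "{j. j < len m \<and> freq (start m + j) * y \<le> 1} = {..<len m}" by auto
  then show ?thesis by (simp add: riesz_part_def)
qed

text \<open>The errors of the single blocks are summed, with total weight at most 8/3 \<le> 3. The
  bound is independent of \<open>x\<close> and \<open>y\<close>, and both the upper and the lower
  estimates of the final function rest on it.\<close>

lemma Re_suminf_block_approx:
  assumes y: "y > 0" and sums: "(\<lambda>m. block m (Complex x y)) sums s"
    and n: "\<And>m. m \<ge> n \<Longrightarrow> freq (start m) * y > 1"
  shows "\<bar>Re s - (\<Sum>m<n. riesz_part x y m)\<bar> \<le> 6 * exp 2"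
proof -
  have "(\<lambda>m. riesz_part x y m) sums (\<Sum>m<n. riesz_part x y m)"
    using n y by (intro sums_finite riesz_part_eq_0) auto
  from sums_diff[OF sums_Re[OF sums] this]
  have "\<bar>Re s - (\<Sum>m<n. riesz_part x y m)\<bar> =
    norm (\<Sum>m. Re (block m (Complex x y)) - riesz_part x y m)"
    by (simp add: sums_iff)
  also have "\<dots> \<le> (\<Sum>m. 2 * exp 2 * block_weight y m)"
    using y by (intro norm_suminf_le summable_mult summable_block_weight) (auto intro: block_approx)
  also have "\<dots> = 2 * exp 2 * suminf (block_weight y)"
    by (intro suminf_mult summable_block_weight y)
  also have "\<dots> \<le> 2 * exp 2 * 3"
    using suminf_block_weight_le[OF y] by (intro mult_left_mono) auto
  finally show ?thesis by simp
qed

text \<open>Weierstrass test on the ball of radius \<open>Im z / 2\<close>, where imaginary parts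
  stay at least \<open>Im z / 2\<close>.\<close>

lemma block_series_exists:
  "\<exists>g g'. \<forall>z\<in>{z. Im z > 0}. (\<lambda>m. block m z) sums g z \<and>
     (\<lambda>m. \<Sum>j<len m. deriv (riesz_term (1 / amp m) (start m) j) z) sums g' z \<and>
     (g has_field_derivative g' z) (at z)"
proof (rule series_and_derivative_comparison_local)
  show "open {z. Im z > 0}" by (rule open_halfspace_Im_gt)
  show "(block m has_field_derivative (\<Sum>j<len m. deriv (riesz_term (1 / amp m) (start m) j) z)) (at z)"
    for m z by (rule block_has_field_derivative)
  fix z assume z: "z \<in> {z. Im z > 0}"
  define y where "y = Im z / 2"
  have y: "y > 0" using z by (simp add: y_def)
  have "norm (block m u) \<le> 2 / y * block_weight y m" if "u \<in> ball z y" for m u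
  proof -
    have "\<bar>Im z - Im u\<bar> \<le> y"
      using abs_Im_le_cmod[of "z - u"] that by (simp add: dist_norm)
    then have "Im u \<ge> y" unfolding y_def by linarith
    then show ?thesis using y by (intro norm_block_le)
  qed
  then show "\<exists>d h. 0 < d \<and> summable h \<and>
     (\<forall>\<^sub>F m in sequentially. \<forall>u\<in>ball z d \<inter> {z. Im z > 0}. norm (block m u) \<le> h m)"
    using y by (intro exI[of _ y] exI[of _ "\<lambda>m. 2 / y * block_weight y m"])
      (auto intro!: summable_mult summable_block_weight always_eventually)
qed

text \<open>The weights at height \<open>Im z\<close> have bounded sum, so only the factor
  \<open>1 / Im z\<close> remains.\<close>

lemma norm_deriv_series_le:
  assumes "Im z > 0"
    and sums: "(\<lambda>m. \<Sum>j<len m. deriv (riesz_term (1 / amp m) (start m) j) z) sums d"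
  shows "norm d \<le> 6 * exp (3/2) / Im z"
proof -
  have "norm d \<le> (\<Sum>m. 2 * exp (3/2) / Im z * block_weight (Im z) m)"
    unfolding sums_unique[OF sums] using assms
    by (intro norm_suminf_le summable_mult summable_block_weight norm_deriv_block_le)
  also have "\<dots> = 2 * exp (3/2) / Im z * suminf (block_weight (Im z))"
    using assms by (intro suminf_mult summable_block_weight)
  also have "\<dots> \<le> 2 * exp (3/2) / Im z * 3"
    using suminf_block_weight_le[of "Im z"] assms by (intro mult_left_mono) auto
  finally show ?thesis by simp
qed

section \<open>Membership in the growth space and in the Bloch class\<close>

text \<open>By the Cauchy-Riemann equations the gradient of a real part is the conjugate of the
  complex derivative.\<close>

lemma GDERIV_Re:
  assumes "(g has_field_derivative d) (at (Complex (fst p) (snd p)))"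
  shows "GDERIV (\<lambda>p. Re (g (Complex (fst p) (snd p)))) p :> (Re d, - Im d)"
proof -
  have "((\<lambda>p. Complex (fst p) (snd p)) has_derivative (\<lambda>h. Complex (fst h) (snd h))) (at p)"
    unfolding Complex_eq by (intro derivative_intros)
  from has_derivative_compose[OF this, of g "(*) d"]
  have "((\<lambda>p. g (Complex (fst p) (snd p))) has_derivative (\<lambda>h. d * Complex (fst h) (snd h))) (at p)"
    using assms by (simp add: has_field_derivative_def)
  from bounded_linear.has_derivative[OF bounded_linear_Re this]
  show ?thesis by (simp add: gderiv_def inner_prod_def mult.commute)
qed

lemma harmonic_on_Re:
  assumes holo: "g holomorphic_on {z. Im z > 0}"
  shows "harmonic_on (\<lambda>p. Re (g (Complex (fst p) (snd p)))) upper_half_plane"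
proof -
  define C where "C p = Complex (fst p) (snd p)" for p
  define H where "H = {z. Im z > 0}"
  have H: "open H" unfolding H_def by (rule open_halfspace_Im_gt)
  have C: "C p \<in> H" if "p \<in> upper_half_plane" for p
    using that by (simp add: C_def H_def upper_half_plane_def)
  have g: "g holomorphic_on H" "deriv g holomorphic_on H" "deriv (deriv g) holomorphic_on H"
    using holo H by (auto simp: H_def intro!: holomorphic_deriv)
  have "continuous_on upper_half_plane C"
    unfolding C_def Complex_eq by (intro continuous_intros)
  then have cont: "continuous_on upper_half_plane (\<lambda>p. deriv (deriv g) (C p))"
    by (rule continuous_on_compose2[OF holomorphic_on_imp_continuous_on[OF g(3)]]) (use C in auto)
  have 1: "GDERIV (\<lambda>p. Re (g (C p))) p :> (Re (deriv g (C p)), - Im (deriv g (C p)))"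
    if "p \<in> upper_half_plane" for p
    using GDERIV_Re[OF holomorphic_derivI[OF g(1) H C[OF that], unfolded C_def]]
    by (simp add: C_def)
  have 2: "GDERIV (\<lambda>p. Re (deriv g (C p))) p :> (Re (deriv (deriv g) (C p)), - Im (deriv (deriv g) (C p)))"
    if "p \<in> upper_half_plane" for p
    using GDERIV_Re[OF holomorphic_derivI[OF g(2) H C[OF that], unfolded C_def]]
    by (simp add: C_def)
  \<comment> \<open>The gradient formula is applied to \<i> times \<open>deriv g\<close>, whose real
    part is \<open>- Im (deriv g (C p))\<close>.\<close>
  have 3: "GDERIV (\<lambda>p. - Im (deriv g (C p))) p :> (- Im (deriv (deriv g) (C p)), - Re (deriv (deriv g) (C p)))"
    if "p \<in> upper_half_plane" for p
    using GDERIV_Re[OF DERIV_cmult[OF holomorphic_derivI[OF g(2) H C[OF that], unfolded C_def], of \<i>]]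
    by (simp add: C_def)
  show ?thesis unfolding harmonic_on_def C_def [symmetric]
    by (rule exI[of _ "\<lambda>p. Re (deriv g (C p))"], rule exI[of _ "\<lambda>p. - Im (deriv g (C p))"],
        rule exI[of _ "\<lambda>p. Re (deriv (deriv g) (C p))"],
        rule exI[of _ "\<lambda>p. - Im (deriv (deriv g) (C p))"],
        rule exI[of _ "\<lambda>p. - Im (deriv (deriv g) (C p))"],
        rule exI[of _ "\<lambda>p. - Re (deriv (deriv g) (C p))"])
       (intro conjI ballI 1 2 3 continuous_intros cont, auto)
qed

section \<open>Comparison of \<open>w\<^sub>0\<close> with the amplitudes of the visible
  blocks\<close>

lemma w0_ge_1: "y > 0 \<Longrightarrow> w\<^sub>0 y \<ge> 1"
proof (cases "y \<le> 1")
  case True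
  assume "y > 0"
  then have "exp 1 \<le> exp 1 / y" using True by (simp add: field_simps)
  then have "1 \<le> ln (exp 1 / y)" using \<open>y > 0\<close> by (subst ln_ge_iff) auto
  then show ?thesis using True by (simp add: w\<^sub>0_def)
qed (simp add: w\<^sub>0_def)

lemma power4_le_freq: "4 ^ k \<le> freq k"
proof -
  have "1 * 4 ^ k \<le> 2 * pi * 4 ^ k" using pi_ge_two by (intro mult_right_mono) auto
  then show ?thesis by (simp add: freq_def)
qed

lemma less_freq: "real k < freq k"
proof -
  have "k < 4 ^ k" by (induction k) auto
  then have "real k < 4 ^ k" by (metis of_nat_less_iff of_nat_numeral of_nat_power)
  then show ?thesis using power4_le_freq[of k] by linarith
qed

lemma index_less_start: "m < start m"
proof -
  have "m < 100 ^ m" "amp m < 4 ^ amp m"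
    by (rule less_le_trans[OF less_exp[of m]], rule power_mono; simp)
       (rule less_le_trans[OF less_exp], rule power_mono; simp)
  then show ?thesis by (simp add: amp_def start_def)
qed

text \<open>With M = \<open>amp m\<close>, exp (exp M) \<le> 4^(4^M) \<le>
  \<open>freq (start m)\<close> \<le> 1/y, and two logarithms give the claim.\<close>

lemma amp_le_w0:
  assumes "y > 0" "freq (start m) * y \<le> 1"
  shows "amp m \<le> w\<^sub>0 y"
proof -
  define M where "M = amp m"
  have e: "exp 1 \<le> (4::real)" using exp_le by linarith
  have exp_le_power4: "exp (real n) \<le> 4 ^ n" for n
    using power_mono[OF e, of n] by (simp flip: exp_of_nat_mult)
  have "freq (start m) * y \<ge> 1 * y" using assms freq_ge_1 by (intro mult_right_mono) auto
  then have "y \<le> 1" using assms by linarith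
  have "exp (exp (real M)) \<le> exp (real (start m))"
    using exp_le_power4[of M] by (simp add: start_def M_def)
  also have "\<dots> \<le> 4 ^ start m" by (rule exp_le_power4)
  also have "\<dots> \<le> freq (start m)" by (rule power4_le_freq)
  also have "\<dots> \<le> 1 / y" using assms by (simp add: field_simps)
  also have "\<dots> \<le> exp 1 / y" using assms by (simp add: divide_right_mono)
  finally have "exp (real M) \<le> ln (exp 1 / y)"
    using assms by (subst ln_ge_iff) auto
  moreover from this have "0 < ln (exp 1 / y)" using exp_gt_zero less_le_trans by blast
  ultimately have "real M \<le> ln (ln (exp 1 / y))"
    by (subst ln_ge_iff)
  then show ?thesis using \<open>y \<le> 1\<close> by (simp add: w\<^sub>0_def M_def)
qed

text \<open>The frequency is one past the last of block \<open>m\<close>, so at this height the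
  whole block is visible and no later block is.\<close>

definition height :: "nat \<Rightarrow> real" where
  "height m = 1 / freq (start m + len m)"

text \<open>With M = \<open>amp m\<close>, the index k is at most 2 * 4^M, so
  \<open>ln (freq k)\<close> is of order at most 4^M and a second logarithm gives order M. The 7
  comes from 2 (M + 2) + 1 \<le> 7 M for M \<ge> 1.\<close>

lemma w0_height_le: "w\<^sub>0 (height m) \<le> 7 * amp m"
proof -
  define M k where "M = amp m" and "k = start m + len m"
  define P where "P = (4::real) ^ M"
  have M: "M \<ge> 1" by (simp add: M_def Suc_le_eq)
  have "(2::real) \<le> exp 1" using exp_ge_add_one_self[of 1] by simp
  then have "(2::real)\<^sup>2 \<le> (exp 1)\<^sup>2" by (intro power_mono) auto
  then have "(4::real) \<le> exp 2" by (simp flip: exp_double)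
  then have power4_le: "(4::real) ^ n \<le> exp (2 * real n)" for n
    using power_mono[of 4 "exp 2 :: real" n] by (simp flip: exp_of_nat_mult add: mult.commute)
  have f: "freq k \<ge> 1" by (rule freq_ge_1)
  have ln_le: "ln x \<le> c" if "x > 0" "x \<le> exp c" for x c :: real
    using that by (metis exp_ln exp_le_cancel_iff)
  have "freq k \<le> 4 ^ (k + 2)"
    unfolding freq_def power_add using pi_less_4 by (simp add: mult.commute)
  also have "\<dots> \<le> exp (2 * real (k + 2))" by (rule power4_le)
  finally have "ln (freq k) \<le> 2 * real (k + 2)"
    using f by (intro ln_le) auto
  moreover have "real k \<le> 2 * P"
  proof -
    have "k \<le> 2 * 4 ^ M"
      using square_le_power4[of M] by (simp add: k_def start_def len_def M_def)
    then have "real k \<le> real (2 * 4 ^ M)" by (rule of_nat_mono)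
    then show ?thesis by (simp add: P_def)
  qed
  moreover have "1 \<le> P" by (simp add: P_def)
  moreover have "1 + a \<le> 16 * P" if "a \<le> 2 * real (k + 2)" "real k \<le> 2 * P" "1 \<le> P" for a
    using that by simp
  ultimately have "1 + ln (freq k) \<le> 16 * P" by blast
  also have "\<dots> = 4 ^ (M + 2)" by (simp add: P_def)
  also have "\<dots> \<le> exp (2 * real (M + 2))" by (rule power4_le)
  finally have "ln (1 + ln (freq k)) \<le> 2 * real (M + 2)"
    using f by (intro ln_le) (auto intro!: add_pos_nonneg ln_ge_zero)
  moreover have "w\<^sub>0 (height m) = ln (1 + ln (freq k)) + 1"
    using f by (simp add: w\<^sub>0_def height_def k_def ln_mult)
  ultimately show ?thesis using M by (simp add: M_def)
qed

lemma sum_amp_le: "(\<Sum>m<n. 2 * real (amp m)) \<le> 2/99 * real (amp n)"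
  by (induction n) (auto simp: amp_def)

text \<open>The last amplitude not exceeding \<open>W\<close> dominates: it contributes at most 2 W,
  and all earlier ones a small fraction of that.\<close>

lemma sum_amp_le_bound:
  assumes "W \<ge> 0"
  shows "(\<Sum>m<n. if real (amp m) \<le> W then 2 * real (amp m) else 0) \<le> 4 * W"
proof (induction n)
  case (Suc n)
  show ?case
  proof (cases "real (amp n) \<le> W")
    case True
    have "(\<Sum>m<n. if real (amp m) \<le> W then 2 * real (amp m) else 0) \<le> (\<Sum>m<n. 2 * real (amp m))"
      by (intro sum_mono) auto
    with sum_amp_le[of n] True show ?thesis by simp
  qed (use Suc in simp)
qed (use assms in simp)

theorem proposition4p1:
  shows "\<exists>(A::real) (v :: real \<times> real \<Rightarrow> real) (k\<^sub>0::nat) (y :: nat \<Rightarrow> real).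
    A > 0 \<and>
    v \<in> harmonic_growth_space w\<^sub>0 \<inter> bloch_class \<and>
    (\<forall>k\<ge>k\<^sub>0. y k > 0) \<and>
    y \<longlonglongrightarrow> 0 \<and>
    (\<forall>k\<ge>k\<^sub>0. measure lebesgue {t \<in> {0..1}. \<bar>v (t, y k)\<bar> \<ge> w\<^sub>0 (y k) / A} \<ge> 1 / 10)"
proof -
  obtain g g' where g:
    "\<And>z. Im z > 0 \<Longrightarrow> (\<lambda>m. block m z) sums g z"
    "\<And>z. Im z > 0 \<Longrightarrow> (\<lambda>m. \<Sum>j<len m. deriv (riesz_term (1 / amp m) (start m) j) z) sums g' z"
    "\<And>z. Im z > 0 \<Longrightarrow> (g has_field_derivative g' z) (at z)"
    using block_series_exists by auto
  define v where "v p = Re (g (Complex (fst p) (snd p)))" for p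
  have holo: "g holomorphic_on {z. Im z > 0}"
    using g(3) by (auto simp: holomorphic_on_open open_halfspace_Im_gt)
  then have harmonic: "harmonic_on v upper_half_plane"
    unfolding v_def by (rule harmonic_on_Re)
  have approx: "\<bar>v (x, y) - (\<Sum>m<n. riesz_part x y m)\<bar> \<le> 6 * exp 2"
    if "y > 0" "\<And>m. m \<ge> n \<Longrightarrow> freq (start m) * y > 1" for x y n
    using Re_suminf_block_approx[OF that(1) g(1) that(2)] that(1) by (simp add: v_def)

  have "\<bar>v (x, y)\<bar> \<le> (4 + 6 * exp 2) * w\<^sub>0 y" if y: "y > 0" for x y
  proof -
    \<comment> \<open>Blocks from \<open>n\<close> on are invisible at height \<open>y\<close>,
      because \<open>freq (start m) > start m > m\<close>.\<close>
    obtain n where n: "real n > 1 / y" using reals_Archimedean2 by blast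
    have "freq (start m) * y > 1" if "m \<ge> n" for m
    proof -
      have "1 / y < freq (start m)"
        using n that index_less_start[of m] less_freq[of "start m"] by linarith
      then show ?thesis using y by (simp add: field_simps)
    qed
    from approx[where x = x and n = n, OF y this]
    have "\<bar>v (x, y)\<bar> \<le> \<bar>\<Sum>m<n. riesz_part x y m\<bar> + 6 * exp 2" by linarith
    \<comment> \<open>A block contributes only if its lowest frequency is visible, and then its
      amplitude is at most \<open>w\<^sub>0 y\<close>.\<close>
    also have "\<bar>\<Sum>m<n. riesz_part x y m\<bar> \<le>
        (\<Sum>m<n. if real (amp m) \<le> w\<^sub>0 y then 2 * real (amp m) else 0)"
    proof (intro sum_abs[THEN order_trans] sum_mono)
      show "\<bar>riesz_part x y m\<bar> \<le> (if real (amp m) \<le> w\<^sub>0 y then 2 * real (amp m) else 0)" for m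
        using abs_riesz_part_le[of x y m] riesz_part_eq_0[of m y x] amp_le_w0[of y m] y
        by (cases "freq (start m) * y \<le> 1") auto
    qed
    also have "\<dots> \<le> 4 * w\<^sub>0 y"
      using w0_ge_1[OF y] by (intro sum_amp_le_bound) simp
    also have "6 * exp 2 \<le> 6 * exp 2 * w\<^sub>0 y"
      using w0_ge_1[OF y] by simp
    finally show ?thesis by (simp add: algebra_simps)
  qed
  then have growth: "v \<in> harmonic_growth_space w\<^sub>0"
    using harmonic by (auto simp: harmonic_growth_space_def)

  have "\<exists>G. GDERIV v (x, y) :> G \<and> norm G \<le> 6 * exp (3/2) / y" if y: "y > 0" for x y
  proof (intro exI conjI)
    define d where "d = g' (Complex x y)"
    show "GDERIV v (x, y) :> (Re d, - Im d)"
      unfolding v_def d_def using y by (intro GDERIV_Re) (simp add: g(3))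
    have "norm (Re d, - Im d) = norm d" by (simp add: norm_Pair cmod_def)
    also have "\<dots> \<le> 6 * exp (3/2) / y"
      using norm_deriv_series_le[OF _ g(2), of "Complex x y"] y by (simp add: d_def)
    finally show "norm (Re d, - Im d) \<le> 6 * exp (3/2) / y" .
  qed
  then have bloch: "v \<in> bloch_class"
    using harmonic unfolding bloch_class_def
    by (intro CollectI conjI exI[of _ "6 * exp (3/2)"] allI impI) auto

  have height: "height k > 0" for k by (simp add: height_def)
  have tendsto: "height \<longlonglongrightarrow> 0"
  proof (rule tendsto_sandwich[OF _ _ tendsto_const LIMSEQ_inverse_real_of_nat])
    have "height k \<le> inverse (real (Suc k))" for k
    proof -
      have "real (Suc k) \<le> freq (start k + len k)"
        using index_less_start[of k] less_freq[of "start k + len k"] by linarith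
      then show ?thesis by (simp add: height_def inverse_eq_divide frac_le)
    qed
    then show "\<forall>\<^sub>F k in sequentially. height k \<le> inverse (real (Suc k))" by simp
  qed (use height in \<open>simp add: less_imp_le\<close>)

  \<comment> \<open>With M = \<open>amp k\<close>, block k gives at least 2M/5 on the chosen set,
    the earlier blocks at most 2M/99, and the error is at most 6 * 9 = 54. As k \<ge> 2 gives M
    \<ge> 10000, more than 7M/24 remains, which is at least
    \<open>w\<^sub>0 (height k) / 24\<close>.\<close>
  have large: "measure lebesgue {t \<in> {0..1}. \<bar>v (t, height k)\<bar> \<ge> w\<^sub>0 (height k) / 24} \<ge> 1 / 10"
    if k: "k \<ge> 2" for k
  proof -
    define B where "B t = Im (riesz (1 / amp k) (start k) (len k) (complex_of_real t))" for t
    define S where "S = {t \<in> {0..1}. \<bar>v (t, height k)\<bar> \<ge> w\<^sub>0 (height k) / 24}"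
    have "continuous_on {0..1} (\<lambda>t. v (t, height k))"
      unfolding v_def
      by (intro continuous_intros continuous_on_compose2[OF holomorphic_on_imp_continuous_on[OF holo]])
         (use height in \<open>auto simp: Complex_eq intro!: continuous_intros\<close>)
    then have S: "S \<in> lmeasurable"
      unfolding S_def by (rule lmeasurable_superlevel)
    have B: "{t \<in> {0..1}. \<bar>B t\<bar> \<ge> 2/5} \<in> lmeasurable"
      unfolding B_def by (intro lmeasurable_superlevel continuous_on_Im_riesz)
    have subset: "{t \<in> {0..1}. \<bar>B t\<bar> \<ge> 2/5} \<subseteq> S"
    proof
      fix t assume t: "t \<in> {t \<in> {0..1}. \<bar>B t\<bar> \<ge> 2/5}"
      \<comment> \<open>Later blocks are invisible at this height, so only block k, in full, and its
        predecessors enter the approximation.\<close>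
      have "freq (start m) * height k > 1" if "m \<ge> Suc k" for m
      proof -
        have "start k + len k < start m"
          using block_end_less[of k] start_mono[OF that] by simp
        then have "freq (start k + len k) < freq (start m)"
          by (simp add: freq_def)
        then show ?thesis by (simp add: height_def)
      qed
      from approx[where x = t and n = "Suc k", OF height this]
      have "\<bar>v (t, height k) - ((\<Sum>m<k. riesz_part t (height k) m) + riesz_part t (height k) k)\<bar> \<le> 6 * exp 2"
        by simp
      moreover have "riesz_part t (height k) k = amp k * B t"
        unfolding B_def using height by (intro riesz_part_full) (simp_all add: height_def)
      moreover have "\<bar>\<Sum>m<k. riesz_part t (height k) m\<bar> \<le> 2 / 99 * amp k"
      proof -
        have "\<bar>\<Sum>m<k. riesz_part t (height k) m\<bar> \<le> (\<Sum>m<k. 2 * real (amp m))"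
          by (intro sum_abs[THEN order_trans] sum_mono abs_riesz_part_le)
        also have "\<dots> \<le> 2 / 99 * amp k" by (rule sum_amp_le)
        finally show ?thesis .
      qed
      moreover have "\<bar>amp k * B t\<bar> \<ge> amp k * (2/5)"
        unfolding abs_mult using t by (intro mult_mono) auto
      moreover have "exp 2 \<le> (9::real)"
        using power_mono[OF exp_le, of 2] by (simp flip: exp_double)
      moreover have "real (amp k) \<ge> 10000"
        using power_increasing[OF k, of "100::real"] by (simp add: amp_def)
      moreover have "w\<^sub>0 (height k) \<le> 7 * amp k" by (rule w0_height_le)
      ultimately have "w\<^sub>0 (height k) / 24 \<le> \<bar>v (t, height k)\<bar>" by linarith
      then show "t \<in> S" using t by (simp add: S_def)
    qed
    have "1/10 \<le> measure lebesgue {t \<in> {0..1}. \<bar>B t\<bar> \<ge> 2/5}"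
      unfolding B_def by (intro measure_abs_Im_riesz_ge abs_step_le len_step_squared)
    also have "\<dots> \<le> measure lebesgue S"
      by (rule measure_mono_fmeasurable[OF subset fmeasurableD[OF B] S])
    finally show ?thesis unfolding S_def .
  qed
  show ?thesis
    by (rule exI[of _ 24], rule exI[of _ v], rule exI[of _ 2], rule exI[of _ height])
       (intro conjI IntI allI impI growth bloch height tendsto large, simp)
qed

end
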